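(* For every $n\ge1$, the semigroup $\mathcal{ODCT}_n$ is left adequate; i.e. every $\mathcal{L}^*$-class of $\mathcal{ODCT}_n$ contains an idempotent, and the set $E(\mathcal{ODCT}_n)$ of idempotents of $\mathcal{ODCT}_n$ is a commutative subsemigroup (a semilattice).
   Context: $[n]=\{1,2,\ldots,n\}$ with its usual order. Maps are written on the right of their arguments. $\mathcal{ODCT}_n$ is the semigroup (under composition, $x(\alpha\beta)=(x\alpha)\beta$) of all maps $\alpha:[n]\to[n]$ that are contractions ($|x\alpha-y\alpha|\le|x-y|$ for all $x,y\in[n]$), order-preserving ($x\le y\Rightarrow x\alpha\le y\alpha$) and order-decreasing ($x\alpha\le x$ for all $x\in[n]$). On a semigroup $S$, $\mathcal{L}^*=\{(\alpha,\beta)\in S\times S: \text{for all }\mu,\lambda\in S^1,\ \alpha\mu=\alpha\lambda \iff \beta\mu=\beta\lambda\}$. A semigroup is called left abundant here if each of its $\mathcal{L}^*$-classes contains an idempotent, and left adequate if it is left abundant and its idempotents form a commutative subsemigroup. *)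

theory Defs
  imports "HOL-Library.FuncSet"
begin

definition semigroup_on :: "'a set \<Rightarrow> ('a \<Rightarrow> 'a \<Rightarrow> 'a) \<Rightarrow> bool" where
  "semigroup_on S m \<longleftrightarrow>
     S \<noteq> {} \<and> (\<forall>a\<in>S. \<forall>b\<in>S. m a b \<in> S) \<and>
     (\<forall>a\<in>S. \<forall>b\<in>S. \<forall>c\<in>S. m (m a b) c = m a (m b c))"

definition has_identity :: "'a set \<Rightarrow> ('a \<Rightarrow> 'a \<Rightarrow> 'a) \<Rightarrow> bool" where
  "has_identity S m \<longleftrightarrow> (\<exists>e\<in>S. \<forall>a\<in>S. m e a = a \<and> m a e = a)"

text \<open>The semigroup with identity adjoined if necessary: an element \<open>a\<close> of \<open>S\<close> is
  represented by \<open>Some a\<close>, and \<open>None\<close> is the new identity, which is present only if \<open>S\<close>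
  has no identity of its own.\<close>

definition adjoin_one :: "'a set \<Rightarrow> ('a \<Rightarrow> 'a \<Rightarrow> 'a) \<Rightarrow> 'a option set" where
  "adjoin_one S m = Some ` S \<union> (if has_identity S m then {} else {None})"

fun mult_one :: "('a \<Rightarrow> 'a \<Rightarrow> 'a) \<Rightarrow> 'a option \<Rightarrow> 'a option \<Rightarrow> 'a option" where
  "mult_one m (Some a) (Some b) = Some (m a b)"
| "mult_one m None y = y"
| "mult_one m x None = x"

definition L_star :: "'a set \<Rightarrow> ('a \<Rightarrow> 'a \<Rightarrow> 'a) \<Rightarrow> ('a \<times> 'a) set" where
  "L_star S m = {(a, b) \<in> S \<times> S. \<forall>u\<in>adjoin_one S m. \<forall>v\<in>adjoin_one S m.
     mult_one m (Some a) u = mult_one m (Some a) v \<longleftrightarrow>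
     mult_one m (Some b) u = mult_one m (Some b) v}"

definition idempotents :: "'a set \<Rightarrow> ('a \<Rightarrow> 'a \<Rightarrow> 'a) \<Rightarrow> 'a set" where
  "idempotents S m = {e \<in> S. m e e = e}"

text \<open>In part of the literature this one-sided condition, on the classes of \<open>L_star\<close>, is
  called right abundance (and correspondingly right adequacy).\<close>

definition left_abundant :: "'a set \<Rightarrow> ('a \<Rightarrow> 'a \<Rightarrow> 'a) \<Rightarrow> bool" where
  "left_abundant S m \<longleftrightarrow> (\<forall>C \<in> S // L_star S m. C \<inter> idempotents S m \<noteq> {})"

definition commutative_subsemigroup :: "'a set \<Rightarrow> 'a set \<Rightarrow> ('a \<Rightarrow> 'a \<Rightarrow> 'a) \<Rightarrow> bool" where
  "commutative_subsemigroup E S m \<longleftrightarrow>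
     E \<subseteq> S \<and> semigroup_on E m \<and> (\<forall>e\<in>E. \<forall>f\<in>E. m e f = m f e)"

definition left_adequate :: "'a set \<Rightarrow> ('a \<Rightarrow> 'a \<Rightarrow> 'a) \<Rightarrow> bool" where
  "left_adequate S m \<longleftrightarrow>
     left_abundant S m \<and> commutative_subsemigroup (idempotents S m) S m"

text \<open>A map from \<open>{1..n}\<close> to itself is an extensional function on \<open>nat\<close>, so that equality of
  maps is equality of functions. Maps are written on the right of their arguments, so
  in the product of \<open>\<alpha>\<close> and \<open>\<beta>\<close> the map \<open>\<alpha>\<close> is applied first.\<close>

definition map_mult :: "nat \<Rightarrow> (nat \<Rightarrow> nat) \<Rightarrow> (nat \<Rightarrow> nat) \<Rightarrow> (nat \<Rightarrow> nat)" where
  "map_mult n \<alpha> \<beta> = compose {1..n} \<beta> \<alpha>"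

definition contraction_on :: "nat set \<Rightarrow> (nat \<Rightarrow> nat) \<Rightarrow> bool" where
  "contraction_on A \<alpha> \<longleftrightarrow>
     (\<forall>x\<in>A. \<forall>y\<in>A. \<bar>int (\<alpha> x) - int (\<alpha> y)\<bar> \<le> \<bar>int x - int y\<bar>)"

definition ODCT :: "nat \<Rightarrow> (nat \<Rightarrow> nat) set" where
  "ODCT n = {\<alpha> \<in> {1..n} \<rightarrow>\<^sub>E {1..n}.
     contraction_on {1..n} \<alpha> \<and> mono_on {1..n} \<alpha> \<and> (\<forall>x\<in>{1..n}. \<alpha> x \<le> x)}"

end

theory Submission
  imports Defs
begin

text \<open>
  The decreasing condition forces \<open>1\<close> to be fixed, and an order-preserving contraction
  cannot jump by more than one, so by a discrete intermediate value argument the image of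
  \<open>\<alpha>\<close> is the initial segment \<open>{1..\<alpha> n}\<close> (\<open>image_ODCT\<close>). Two facts follow.

  For abundance: equality of \<open>\<alpha>\<mu>\<close> and \<open>\<alpha>\<lambda>\<close> only says that \<open>\<mu>\<close> and \<open>\<lambda>\<close> agree on the
  image of \<open>\<alpha>\<close>, so maps with the same image are related by \<open>L_star\<close>
  (\<open>L_star_if_image_eq\<close>). The truncation \<open>x \<mapsto> min x m\<close> is an idempotent with image
  \<open>{1..m}\<close>, so every class contains a truncation.

  For commutativity: an idempotent fixes its image \<open>{1..m}\<close> pointwise, and by monotonicity
  it sends everything above \<open>m\<close> to \<open>m\<close>. Hence the idempotents are exactly the truncations
  (\<open>idempotents_ODCT\<close>), which compose by taking the minimum of the thresholds.
\<close>

definition truncation :: "nat \<Rightarrow> nat \<Rightarrow> nat \<Rightarrow> nat" where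
  "truncation n m = (\<lambda>x\<in>{1..n}. min x m)"

lemma ODCT_bounds:
  assumes "\<alpha> \<in> ODCT n" "x \<in> {1..n}"
  shows "1 \<le> \<alpha> x" "\<alpha> x \<le> x" "\<alpha> x \<in> {1..n}"
  using assms by (auto simp: ODCT_def PiE_iff)

lemma ODCT_mono: "\<alpha> \<in> ODCT n \<Longrightarrow> x \<in> {1..n} \<Longrightarrow> y \<in> {1..n} \<Longrightarrow> x \<le> y \<Longrightarrow> \<alpha> x \<le> \<alpha> y"
  by (auto simp: ODCT_def mono_on_def)

lemma ODCT_contraction:
  "\<alpha> \<in> ODCT n \<Longrightarrow> x \<in> {1..n} \<Longrightarrow> y \<in> {1..n} \<Longrightarrow> \<bar>int (\<alpha> x) - int (\<alpha> y)\<bar> \<le> \<bar>int x - int y\<bar>"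
  unfolding ODCT_def contraction_on_def by blast

lemma map_mult_apply: "x \<in> {1..n} \<Longrightarrow> map_mult n \<alpha> \<beta> x = \<beta> (\<alpha> x)"
  by (simp add: map_mult_def compose_eq)

lemma map_mult_ODCT:
  assumes a: "\<alpha> \<in> ODCT n" and b: "\<beta> \<in> ODCT n"
  shows "map_mult n \<alpha> \<beta> \<in> ODCT n"
proof -
  have "map_mult n \<alpha> \<beta> \<in> {1..n} \<rightarrow>\<^sub>E {1..n}"
    using ODCT_bounds(3)[OF a] ODCT_bounds(3)[OF b]
    by (simp add: map_mult_def compose_def PiE_iff)
  moreover have "contraction_on {1..n} (map_mult n \<alpha> \<beta>)"
    unfolding contraction_on_def
  proof (intro ballI)
    fix x y assume x: "x \<in> {1..n}" and y: "y \<in> {1..n}"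
    have "\<bar>int (\<beta> (\<alpha> x)) - int (\<beta> (\<alpha> y))\<bar> \<le> \<bar>int (\<alpha> x) - int (\<alpha> y)\<bar>"
      by (intro ODCT_contraction[OF b] ODCT_bounds(3)[OF a] x y)
    also have "\<dots> \<le> \<bar>int x - int y\<bar>"
      by (intro ODCT_contraction[OF a] x y)
    finally show "\<bar>int (map_mult n \<alpha> \<beta> x) - int (map_mult n \<alpha> \<beta> y)\<bar> \<le> \<bar>int x - int y\<bar>"
      by (simp only: map_mult_apply[OF x] map_mult_apply[OF y])
  qed
  moreover have "mono_on {1..n} (map_mult n \<alpha> \<beta>)"
  proof (rule mono_onI)
    fix x y assume x: "x \<in> {1..n}" and y: "y \<in> {1..n}" and "x \<le> y"
    then show "map_mult n \<alpha> \<beta> x \<le> map_mult n \<alpha> \<beta> y"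
      unfolding map_mult_apply[OF x] map_mult_apply[OF y]
      by (intro ODCT_mono[OF b] ODCT_mono[OF a] ODCT_bounds(3)[OF a])
  qed
  moreover have "\<forall>x\<in>{1..n}. map_mult n \<alpha> \<beta> x \<le> x"
  proof
    fix x assume x: "x \<in> {1..n}"
    show "map_mult n \<alpha> \<beta> x \<le> x"
      unfolding map_mult_apply[OF x]
      using ODCT_bounds(2)[OF b ODCT_bounds(3)[OF a x]] ODCT_bounds(2)[OF a x] by (rule order_trans)
  qed
  ultimately show ?thesis
    by (simp add: ODCT_def)
qed

lemma map_mult_assoc:
  assumes "\<alpha> \<in> ODCT n"
  shows "map_mult n (map_mult n \<alpha> \<beta>) \<gamma> = map_mult n \<alpha> (map_mult n \<beta> \<gamma>)"
  using ODCT_bounds(3)[OF assms] by (auto simp: map_mult_def compose_def fun_eq_iff)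

lemma truncation_ODCT: "1 \<le> m \<Longrightarrow> truncation n m \<in> ODCT n"
  by (auto simp: truncation_def ODCT_def contraction_on_def mono_on_def PiE_iff)

lemma semigroup_on_ODCT: "semigroup_on (ODCT n) (map_mult n)"
  unfolding semigroup_on_def
  using truncation_ODCT[of 1 n] map_mult_ODCT map_mult_assoc by blast

text \<open>Truncating at \<open>n\<close> is the identity map, so no identity is adjoined in forming
  \<open>S\<^sup>1\<close>.\<close>

lemma adjoin_one_ODCT:
  assumes "n \<ge> 1"
  shows "adjoin_one (ODCT n) (map_mult n) = Some ` ODCT n"
proof -
  have "map_mult n (truncation n n) \<alpha> = \<alpha> \<and> map_mult n \<alpha> (truncation n n) = \<alpha>"
    if "\<alpha> \<in> ODCT n" for \<alpha>
  proof -
    have ext: "\<alpha> \<in> extensional {1..n}"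
      using that by (auto simp: ODCT_def PiE_iff)
    have "map_mult n (truncation n n) \<alpha> x = \<alpha> x" "map_mult n \<alpha> (truncation n n) x = \<alpha> x"
      if "x \<in> {1..n}" for x
      using that ODCT_bounds(3)[OF \<open>\<alpha> \<in> ODCT n\<close> that]
      by (simp_all add: map_mult_apply truncation_def)
    then show ?thesis
      using ext by (auto simp: map_mult_def intro!: extensionalityI[of _ "{1..n}"])
  qed
  then have "has_identity (ODCT n) (map_mult n)"
    unfolding has_identity_def using truncation_ODCT[OF assms] by blast
  then show ?thesis
    by (simp add: adjoin_one_def)
qed

text \<open>Each step from \<open>x\<close> to \<open>Suc x\<close> raises the value by at most one, so the values
  climb from \<open>\<alpha> 1 = 1\<close> to \<open>\<alpha> n\<close> without skipping any.\<close>

lemma image_ODCT: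
  assumes a: "\<alpha> \<in> ODCT n" and n: "n \<ge> 1"
  shows "\<alpha> ` {1..n} = {1..\<alpha> n}"
proof
  show "\<alpha> ` {1..n} \<subseteq> {1..\<alpha> n}"
    using ODCT_bounds(1)[OF a] ODCT_mono[OF a] by auto
  have "{1..\<alpha> x} \<subseteq> \<alpha> ` {1..x}" if "1 \<le> x" "x \<le> n" for x
    using that
  proof (induction x rule: nat_induct_at_least)
    case base
    then show ?case using ODCT_bounds[OF a, of 1] by auto
  next
    case (Suc x)
    have "\<alpha> (Suc x) \<le> Suc (\<alpha> x)"
      using ODCT_contraction[OF a, of "Suc x" x] Suc by simp
    then have "{1..\<alpha> (Suc x)} \<subseteq> insert (\<alpha> (Suc x)) {1..\<alpha> x}"
      by auto
    also have "\<dots> \<subseteq> \<alpha> ` {1..Suc x}"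
      using Suc by (auto simp: atLeastAtMostSuc_conv)
    finally show ?case .
  qed
  then show "{1..\<alpha> n} \<subseteq> \<alpha> ` {1..n}"
    using n by simp
qed

lemma image_truncation: "1 \<le> m \<Longrightarrow> m \<le> n \<Longrightarrow> truncation n m ` {1..n} = {1..m}"
  using image_ODCT[OF truncation_ODCT, of m n] by (simp add: truncation_def)

lemma map_mult_eq_iff:
  "map_mult n \<alpha> \<mu> = map_mult n \<alpha> \<nu> \<longleftrightarrow> (\<forall>y \<in> \<alpha> ` {1..n}. \<mu> y = \<nu> y)"
  by (auto simp: map_mult_def compose_def fun_eq_iff)

text \<open>By \<open>map_mult_eq_iff\<close>, a map enters the condition defining \<open>L_star\<close> only through its image, because
  every element of \<open>S\<^sup>1\<close> is itself a map.\<close>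

lemma L_star_if_image_eq:
  assumes "\<alpha> \<in> ODCT n" "\<beta> \<in> ODCT n" "\<alpha> ` {1..n} = \<beta> ` {1..n}" "n \<ge> 1"
  shows "(\<alpha>, \<beta>) \<in> L_star (ODCT n) (map_mult n)"
proof -
  have "mult_one (map_mult n) (Some \<alpha>) u = mult_one (map_mult n) (Some \<alpha>) v \<longleftrightarrow>
      mult_one (map_mult n) (Some \<beta>) u = mult_one (map_mult n) (Some \<beta>) v"
    if "u \<in> Some ` ODCT n" "v \<in> Some ` ODCT n" for u v
    using that by (elim imageE) (simp only: mult_one.simps option.inject map_mult_eq_iff assms(3))
  then show ?thesis
    unfolding L_star_def adjoin_one_ODCT[OF assms(4)] using assms(1,2) by blast
qed

lemma truncation_mult:
  "1 \<le> m \<Longrightarrow> map_mult n (truncation n m) (truncation n k) = truncation n (min m k)"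
  by (auto simp: map_mult_def compose_def truncation_def fun_eq_iff)

lemma idempotents_ODCT:
  assumes "n \<ge> 1"
  shows "idempotents (ODCT n) (map_mult n) = truncation n ` {1..n}"
proof
  show "truncation n ` {1..n} \<subseteq> idempotents (ODCT n) (map_mult n)"
    by (auto simp: idempotents_def truncation_ODCT truncation_mult)
  show "idempotents (ODCT n) (map_mult n) \<subseteq> truncation n ` {1..n}"
  proof
    fix e assume "e \<in> idempotents (ODCT n) (map_mult n)"
    then have e: "e \<in> ODCT n" and ee: "map_mult n e e = e"
      by (auto simp: idempotents_def)
    have en: "e n \<in> {1..n}"
      using ODCT_bounds(3)[OF e] assms by simp
    have fixed: "e y = y" if "y \<in> {1..e n}" for y
    proof -
      from that have "y \<in> e ` {1..n}"
        by (simp only: image_ODCT[OF e assms])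
      then obtain x where "x \<in> {1..n}" "y = e x" ..
      then show ?thesis
        using map_mult_apply[of x n e e] by (simp only: ee)
    qed
    have val: "e x = min x (e n)" if x: "x \<in> {1..n}" for x
    proof (cases "x \<le> e n")
      case True
      then show ?thesis using fixed[of x] x by simp
    next
      case False
      \<comment> \<open>The value at \<open>x\<close> is squeezed between those at \<open>e n\<close> and at \<open>n\<close>, which coincide.\<close>
      have "e (e n) \<le> e x" "e x \<le> e n"
        using False x en by (auto intro!: ODCT_mono[OF e])
      then show ?thesis using fixed[of "e n"] en False by simp
    qed
    have "e = truncation n (e n)"
    proof (rule extensionalityI[of _ "{1..n}"])
      show "e \<in> extensional {1..n}"
        using e by (auto simp: ODCT_def PiE_iff)
      show "truncation n (e n) \<in> extensional {1..n}"
        by (simp add: truncation_def)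
      show "e x = truncation n (e n) x" if "x \<in> {1..n}" for x
        using that val[OF that] by (simp add: truncation_def)
    qed
    with en show "e \<in> truncation n ` {1..n}" by blast
  qed
qed

lemma left_abundant_ODCT:
  assumes "n \<ge> 1"
  shows "left_abundant (ODCT n) (map_mult n)"
  unfolding left_abundant_def
proof
  fix C assume "C \<in> ODCT n // L_star (ODCT n) (map_mult n)"
  then obtain \<alpha> where a: "\<alpha> \<in> ODCT n" and C: "C = L_star (ODCT n) (map_mult n) `` {\<alpha>}"
    by (auto elim: quotientE)
  have m: "\<alpha> n \<in> {1..n}"
    using ODCT_bounds(3)[OF a] assms by simp
  have "(\<alpha>, truncation n (\<alpha> n)) \<in> L_star (ODCT n) (map_mult n)"
  proof (rule L_star_if_image_eq[OF a _ _ assms])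
    show "truncation n (\<alpha> n) \<in> ODCT n"
      using m by (simp add: truncation_ODCT)
    show "\<alpha> ` {1..n} = truncation n (\<alpha> n) ` {1..n}"
      using m image_ODCT[OF a assms] image_truncation[of "\<alpha> n" n] by auto
  qed
  then show "C \<inter> idempotents (ODCT n) (map_mult n) \<noteq> {}"
    using m by (auto simp: C idempotents_ODCT[OF assms])
qed

lemma commutative_idempotents_ODCT:
  assumes "n \<ge> 1"
  shows "commutative_subsemigroup (idempotents (ODCT n) (map_mult n)) (ODCT n) (map_mult n)"
proof -
  have "map_mult n e f \<in> truncation n ` {1..n}"
    if "e \<in> truncation n ` {1..n}" "f \<in> truncation n ` {1..n}" for e f
    using that by (auto simp: truncation_mult)
  moreover have "map_mult n e f = map_mult n f e"
    if "e \<in> truncation n ` {1..n}" "f \<in> truncation n ` {1..n}" for e f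
    using that by (auto simp: truncation_mult min.commute)
  moreover have "truncation n ` {1..n} \<subseteq> ODCT n"
    by (auto simp: truncation_ODCT)
  moreover have "truncation n ` {1..n} \<noteq> {}"
    using assms by simp
  ultimately show ?thesis
    unfolding commutative_subsemigroup_def semigroup_on_def idempotents_ODCT[OF assms]
    using map_mult_assoc by (simp add: subset_iff)
qed

theorem theorem15:
  fixes n :: nat
  assumes "n \<ge> 1"
  shows "semigroup_on (ODCT n) (map_mult n) \<and> left_adequate (ODCT n) (map_mult n)"
  using semigroup_on_ODCT left_abundant_ODCT[OF assms] commutative_idempotents_ODCT[OF assms]
  by (simp add: left_adequate_def)

end
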